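(* Every $\omega$-narrow Čech-complete (Hausdorff) topological group is $g$-reversible.
   Context: All topological groups are assumed Hausdorff. A topological group $G$ is called $g$-reversible if every continuous automorphism of $G$ (i.e. every continuous group isomorphism of $G$ onto itself) is an open map. A topological group $G$ is $\omega$-narrow if for every open neighbourhood $U$ of the identity there is an at most countable set $S\subseteq G$ with $G=SU$. A space is Čech-complete if it is a $G_\delta$ subset of its Stone–Čech compactification. *)

theory Defs
  imports "HOL-Analysis.Analysis" "HOL-Algebra.Group"
begin

definition topological_group :: "('a, 'b) monoid_scheme \<Rightarrow> 'a topology \<Rightarrow> bool" where
  "topological_group G T \<longleftrightarrow>
     group G \<and> topspace T = carrier G \<and> Hausdorff_space T \<and>
     continuous_map (prod_topology T T) T (\<lambda>(x, y). x \<otimes>\<^bsub>G\<^esub> y) \<and>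
     continuous_map T T (\<lambda>x. inv\<^bsub>G\<^esub> x)"

definition g_reversible :: "('a, 'b) monoid_scheme \<Rightarrow> 'a topology \<Rightarrow> bool" where
  "g_reversible G T \<longleftrightarrow>
     (\<forall>f. f \<in> iso G G \<and> continuous_map T T f \<longrightarrow> open_map T T f)"

definition omega_narrow :: "('a, 'b) monoid_scheme \<Rightarrow> 'a topology \<Rightarrow> bool" where
  "omega_narrow G T \<longleftrightarrow>
     (\<forall>U. openin T U \<and> \<one>\<^bsub>G\<^esub> \<in> U \<longrightarrow>
        (\<exists>S. S \<subseteq> carrier G \<and> countable S \<and>
             carrier G = {s \<otimes>\<^bsub>G\<^esub> u | s u. s \<in> S \<and> u \<in> U}))"

text \<open>Stone-Cech compactification (Cech's characterisation): a compact Hausdorff space K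
with a dense embedding e of X such that every continuous map X \<rightarrow> [0,1] extends
continuously over K. The carrier type is the cube type indexed by real functions on X,
which is large enough to contain a copy of beta X.
Cech-complete: the image of X is a G-delta subset of (such a) beta X.\<close>
definition stone_cech :: "'a topology \<Rightarrow> 'c topology \<Rightarrow> ('a \<Rightarrow> 'c) \<Rightarrow> bool" where
  "stone_cech X K e \<longleftrightarrow>
     compact_space K \<and> Hausdorff_space K \<and> embedding_map X K e \<and>
     K closure_of (e ` topspace X) = topspace K \<and>
     (\<forall>f. continuous_map X (top_of_set {0..1::real}) f \<longrightarrow>
        (\<exists>g. continuous_map K (top_of_set {0..1::real}) g \<and>
             (\<forall>x\<in>topspace X. g (e x) = f x)))"

definition cech_complete :: "'a topology \<Rightarrow> bool" where
  "cech_complete X \<longleftrightarrow>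
     (\<exists>(K :: (('a \<Rightarrow> real) \<Rightarrow> real) topology) e.
        stone_cech X K e \<and> gdelta_in K (e ` topspace X))"

end

theory Submission
  imports Defs
begin

text \<open>A continuous automorphism \<open>f\<close> is nearly open, that is, \<open>f ` U\<close> lies in the interior of its
  closure for every open \<open>U\<close>: countably many translates of \<open>f ` V\<close> cover the group by
  \<open>\<omega>\<close>-narrowness, so by Baire category the closure of one of them has interior points.
  By an argument of Weston, a nearly open continuous injection of a Cech-complete space into a
  Hausdorff space is open. If \<open>f ` U\<close> were dense near \<open>f p\<close> for a point \<open>p\<close> outside the closure
  of \<open>U\<close>, one could shrink \<open>U\<close> and a neighbourhood of \<open>p\<close> alternately, keeping the images
  close to each other, to two disjoint compact sets whose images cannot be separated.\<close>

text \<open>The property of Cech-complete spaces, in the manner of Frolik and Arhangelskii, which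
  replaces the compactification: \<open>P n\<close> selects the sets that are small of order \<open>n\<close>.\<close>

definition complete_sieve :: "'a topology \<Rightarrow> (nat \<Rightarrow> 'a set \<Rightarrow> bool) \<Rightarrow> bool" where
  "complete_sieve X P \<longleftrightarrow>
     (\<forall>n D x. openin X D \<and> x \<in> D \<longrightarrow>
        (\<exists>U. openin X U \<and> x \<in> U \<and> X closure_of U \<subseteq> D \<and> P n U)) \<and>
     (\<forall>U. (\<forall>n. openin X (U n) \<and> U n \<noteq> {} \<and> U (Suc n) \<subseteq> U n \<and> P n (U n)) \<longrightarrow>
        (\<exists>L. compactin X L \<and> (\<forall>n. L \<subseteq> X closure_of U n) \<and>
             (\<forall>D. openin X D \<and> L \<subseteq> D \<longrightarrow> (\<exists>n. U n \<subseteq> D))))"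

section \<open>Complete sieves and their existence in Cech-complete spaces\<close>

lemma complete_sieve_small:
  assumes "complete_sieve X P" "openin X D" "x \<in> D"
  obtains U where "openin X U" "x \<in> U" "X closure_of U \<subseteq> D" "P n U" "U \<subseteq> D"
proof -
  obtain U where U: "openin X U" "x \<in> U" "X closure_of U \<subseteq> D" "P n U"
    using assms unfolding complete_sieve_def by meson
  moreover have "U \<subseteq> D"
    using U closure_of_subset openin_subset by (metis subset_trans)
  ultimately show thesis using that by blast
qed

lemma complete_sieve_compact:
  assumes "complete_sieve X P"
    and "\<And>n. openin X (U n)" "\<And>n. U n \<noteq> {}" "\<And>n. U (Suc n) \<subseteq> U n" "\<And>n. P n (U n)"
  obtains L where "compactin X L" "\<And>n. L \<subseteq> X closure_of U n"
    "\<And>D. openin X D \<Longrightarrow> L \<subseteq> D \<Longrightarrow> \<exists>n. U n \<subseteq> D"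
proof -
  have "\<forall>n. openin X (U n) \<and> U n \<noteq> {} \<and> U (Suc n) \<subseteq> U n \<and> P n (U n)"
    using assms(2-5) by simp
  then have "\<exists>L. compactin X L \<and> (\<forall>n. L \<subseteq> X closure_of U n) \<and>
      (\<forall>D. openin X D \<and> L \<subseteq> D \<longrightarrow> (\<exists>n. U n \<subseteq> D))"
    by (rule assms(1)[unfolded complete_sieve_def, THEN conjunct2, THEN spec[of _ U], THEN mp])
  then obtain L where L: "compactin X L" "\<forall>n. L \<subseteq> X closure_of U n"
      "\<forall>D. openin X D \<and> L \<subseteq> D \<longrightarrow> (\<exists>n. U n \<subseteq> D)"
    by (elim exE conjE)
  show thesis
    by (rule that[OF L(1)]) (use L in simp_all)
qed

lemma gdelta_in_sequence:
  assumes "gdelta_in X S"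
  obtains B :: "nat \<Rightarrow> 'a set" where "\<And>n. openin X (B n)" "(\<Inter>n. B n) = S"
proof -
  obtain \<U> where \<U>: "countable \<U>" "\<U> \<subseteq> Collect (openin X)" "\<Inter>\<U> = S"
    using assms by (auto simp: gdelta_in_alt intersection_of_def)
  have S: "S \<subseteq> topspace X"
    using assms gdelta_in_subset by blast
  \<comment> \<open>Adding the whole space makes the family nonempty, so that
    \<open>from_nat_into\<close> enumerates exactly it, and leaves the intersection \<open>S\<close>
    unchanged.\<close>
  let ?V = "insert (topspace X) \<U>"
  have r: "range (from_nat_into ?V) = ?V"
    using \<U>(1) by (intro range_from_nat_into) auto
  show thesis
  proof
    show "openin X (from_nat_into ?V n)" for n
    proof -
      have "from_nat_into ?V n \<in> ?V" using r by blast
      then show ?thesis using \<U>(2) by auto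
    qed
    show "(\<Inter>n. from_nat_into ?V n) = S"
      using r S \<U>(3) by auto
  qed
qed

text \<open>Write the image of \<open>X\<close> in the compactification \<open>K\<close> as the
  intersection of open sets \<open>B n\<close>, and call \<open>U\<close> small of order
  \<open>n\<close> if the closure in \<open>K\<close> of its image lies in \<open>B n\<close>. For a
  decreasing sequence of such sets these closures meet in a compact set that stays inside the image
  of \<open>X\<close>; its preimage is \<open>L\<close>.\<close>

lemma cech_complete_imp_complete_sieve:
  assumes "cech_complete X"
  obtains P where "complete_sieve X P"
proof -
  obtain K :: "(('a \<Rightarrow> real) \<Rightarrow> real) topology" and e
    where sc: "stone_cech X K e" and gd: "gdelta_in K (e ` topspace X)"
    using assms unfolding cech_complete_def by blast
  have cK: "compact_space K" and hK: "Hausdorff_space K" and emb: "embedding_map X K e"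
    using sc unfolding stone_cech_def by auto
  have reg: "regular_space K"
    using cK hK compact_Hausdorff_imp_regular_space by blast
  have hom: "homeomorphic_map X (subtopology K (e ` topspace X)) e"
    using emb unfolding embedding_map_def .
  have cont: "continuous_map X K e"
    using hom homeomorphic_imp_continuous_map continuous_map_in_subtopology by blast
  have inj: "inj_on e (topspace X)"
    using hom homeomorphic_map_def by blast
  obtain B :: "nat \<Rightarrow> (('a \<Rightarrow> real) \<Rightarrow> real) set"
    where B: "\<And>n. openin K (B n)" "(\<Inter>n. B n) = e ` topspace X"
    using gdelta_in_sequence[OF gd] by blast
  have pull: "\<exists>D'. openin K D' \<and> D = {x \<in> topspace X. e x \<in> D'}" if "openin X D" for D
  proof -
    have "openin (subtopology K (e ` topspace X)) (e ` D)"
      using hom that homeomorphic_map_openness openin_subset by blast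
    then obtain D' where D': "openin K D'" "e ` D = D' \<inter> e ` topspace X"
      by (auto simp: openin_subtopology)
    have "D = {x \<in> topspace X. e x \<in> D'}"
      using D'(2) inj openin_subset[OF that] by (auto simp: inj_on_def)
    then show ?thesis using D'(1) by blast
  qed
  define P where "P = (\<lambda>n U. K closure_of (e ` U) \<subseteq> B n)"
  have "complete_sieve X P"
    unfolding complete_sieve_def
  proof (intro conjI allI impI; (elim conjE)?)
    fix n D x assume D: "openin X D" "x \<in> D"
    obtain D' where D': "openin K D'" "D = {x \<in> topspace X. e x \<in> D'}"
      using pull[OF D(1)] by blast
    have "openin K (D' \<inter> B n)" "e x \<in> D' \<inter> B n"
      using D D' B by auto
    \<comment> \<open>The closed set \<open>C\<close> controls two closures at once: that of the
      image of \<open>?U\<close> in \<open>K\<close>, which gives \<open>P n\<close>, and, by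
      continuity of \<open>e\<close>, that of \<open>?U\<close> in \<open>X\<close>, which gives
      containment in \<open>D\<close>.\<close>
    then obtain W C where W: "openin K W" "closedin K C" "e x \<in> W" "W \<subseteq> C" "C \<subseteq> D' \<inter> B n"
      using reg unfolding neighbourhood_base_of_closedin[symmetric] neighbourhood_base_of
      by metis
    let ?U = "{z \<in> topspace X. e z \<in> W}"
    have 1: "openin X ?U"
      using cont W(1) openin_continuous_map_preimage by blast
    have 2: "K closure_of (e ` ?U) \<subseteq> C"
      using W by (intro closure_of_minimal) auto
    have 3: "X closure_of ?U \<subseteq> D"
    proof
      fix z assume z: "z \<in> X closure_of ?U"
      then have "e z \<in> C"
        using continuous_map_image_closure_subset[OF cont, of ?U] 2 by blast
      then show "z \<in> D"
        using z W(5) D'(2) closure_of_subset_topspace[of X ?U] by auto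
    qed
    show "\<exists>U. openin X U \<and> x \<in> U \<and> X closure_of U \<subseteq> D \<and> P n U"
      using 1 2 3 W D openin_subset[OF D(1)] unfolding P_def by (intro exI[of _ ?U]) auto
  next
    fix U assume U: "\<forall>n. openin X (U n) \<and> U n \<noteq> {} \<and> U (Suc n) \<subseteq> U n \<and> P n (U n)"
    define C where "C n = K closure_of (e ` U n)" for n
    have UX: "U n \<subseteq> topspace X" for n
      using U openin_subset by blast
    have eUK: "e ` U n \<subseteq> topspace K" for n
      using UX cont continuous_map_image_subset_topspace by blast
    have UC: "e ` U n \<subseteq> C n" for n
      unfolding C_def using closure_of_subset[OF eUK] .
    have clC: "closedin K (C n)" for n
      by (simp add: C_def)
    have decC: "decseq C"
    proof (rule decseq_SucI)
      show "C (Suc n) \<subseteq> C n" for n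
        unfolding C_def using U by (intro closure_of_mono image_mono) blast
    qed
    define M where "M = (\<Inter>n. C n)"
    have CB: "C n \<subseteq> B n" for n
      using U unfolding C_def P_def by blast
    \<comment> \<open>The G-delta property enters here: it keeps \<open>M\<close> out of the
      remainder of the compactification.\<close>
    have MX: "M \<subseteq> e ` topspace X"
      unfolding M_def B(2)[symmetric] using CB by (intro INT_anti_mono) auto
    have "closedin K M"
      unfolding M_def using clC by (intro closedin_INT) auto
    then have cM: "compactin K M"
      using cK closedin_compact_space by blast
    define L where "L = {x \<in> topspace X. e x \<in> M}"
    have eL: "e ` L = M"
      using MX unfolding L_def by auto
    have "compactin (subtopology K (e ` topspace X)) (e ` L)"
      using cM MX eL by (simp add: compactin_subtopology)
    then have cL: "compactin X L"
      using homeomorphic_map_compactness[OF hom, of L] unfolding L_def by blast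
    have LU: "L \<subseteq> X closure_of U n" for n
    proof
      fix x assume x: "x \<in> L"
      show "x \<in> X closure_of U n"
        unfolding in_closure_of
      proof (intro conjI allI impI; (elim conjE)?)
        show "x \<in> topspace X" using x L_def by blast
      next
        fix D assume D: "x \<in> D" "openin X D"
        obtain D' where D': "openin K D'" "D = {x \<in> topspace X. e x \<in> D'}"
          using pull[OF D(2)] by blast
        have "e x \<in> K closure_of (e ` U n)" "e x \<in> D'"
          using x D D' unfolding L_def M_def C_def by auto
        then obtain y where "y \<in> U n" "e y \<in> D'"
          using D'(1) unfolding in_closure_of by blast
        then show "\<exists>y. y \<in> U n \<and> y \<in> D"
          using D'(2) UX by blast
      qed
    qed
    have LD: "\<exists>n. U n \<subseteq> D" if D: "openin X D" "L \<subseteq> D" for D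
    proof (rule ccontr)
      assume no: "\<nexists>n. U n \<subseteq> D"
      obtain D' where D': "openin K D'" "D = {x \<in> topspace X. e x \<in> D'}"
        using pull[OF D(1)] by blast
      \<comment> \<open>By compactness of \<open>K\<close>, a decreasing sequence of nonempty closed
        sets has a common point; here it would be a point of \<open>M\<close> outside
        \<open>D'\<close>, although \<open>L\<close> lies in \<open>D\<close>.\<close>
      have "(\<Inter>n. C n - D') \<noteq> {}"
      proof (rule compact_space_imp_nest[OF cK])
        show "closedin K (C n - D')" for n
          using clC D'(1) by blast
        show "C n - D' \<noteq> {}" for n
          using no UC[of n] D'(2) UX[of n] by blast
        show "decseq (\<lambda>n. C n - D')"
          using decC by (fastforce simp: decseq_def)
      qed
      then obtain z where "z \<in> M" "z \<notin> D'"
        unfolding M_def by auto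
      moreover obtain x where "x \<in> L" "z = e x"
        using eL \<open>z \<in> M\<close> by blast
      ultimately show False
        using D(2) D'(2) by blast
    qed
    show "\<exists>L. compactin X L \<and> (\<forall>n. L \<subseteq> X closure_of U n) \<and>
             (\<forall>D. openin X D \<and> L \<subseteq> D \<longrightarrow> (\<exists>n. U n \<subseteq> D))"
      using cL LU LD by blast
  qed
  then show thesis using that by blast
qed

section \<open>Baire category\<close>

text \<open>If every \<open>F n\<close> had empty interior, one could choose decreasing nonempty
  open sets \<open>E n\<close>, with the closure of \<open>E (Suc n)\<close> missing
  \<open>F n\<close>. The compact set which the sieve attaches to them is nonempty and misses every
  \<open>F n\<close>.\<close>

lemma complete_sieve_Baire:
  fixes F :: "nat \<Rightarrow> 'a set"
  assumes P: "complete_sieve X P" and ne: "topspace X \<noteq> {}"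
    and F: "\<And>n. closedin X (F n)" and cover: "topspace X \<subseteq> (\<Union>n. F n)"
  obtains n where "X interior_of F n \<noteq> {}"
proof (rule ccontr)
  assume "\<not> thesis"
  then have int: "X interior_of F n = {}" for n
    using that by blast
  have step: "\<exists>E. (openin X E \<and> E \<noteq> {}) \<and> X closure_of E \<subseteq> D - F n \<and> E \<subseteq> D \<and> P n E"
    if D: "openin X D" "D \<noteq> {}" for D n
  proof -
    have "\<not> D \<subseteq> F n"
      using D int interior_of_maximal by blast
    then obtain x where "x \<in> D - F n" by blast
    moreover have "openin X (D - F n)"
      using D F by blast
    ultimately show ?thesis
      using complete_sieve_small[OF P, of "D - F n" x] by (metis Diff_subset empty_iff subset_trans)
  qed
  \<comment> \<open>The condition \<open>P n\<close> falls on \<open>E (Suc n)\<close>, so the sieve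
    is applied below to the shifted sequence.\<close>
  obtain E where E: "\<And>n. openin X (E n) \<and> E n \<noteq> {}"
    "\<And>n. X closure_of E (Suc n) \<subseteq> E n - F n \<and> E (Suc n) \<subseteq> E n \<and> P n (E (Suc n))"
    using dependent_nat_choice[where P = "\<lambda>n E. openin X E \<and> E \<noteq> {}" and
        Q = "\<lambda>n D E. X closure_of E \<subseteq> D - F n \<and> E \<subseteq> D \<and> P n E"] step ne openin_topspace
    by metis
  obtain L where L: "\<And>n. L \<subseteq> X closure_of E (Suc n)"
      "\<And>D. openin X D \<Longrightarrow> L \<subseteq> D \<Longrightarrow> \<exists>n. E (Suc n) \<subseteq> D"
    using complete_sieve_compact[OF P, of "\<lambda>n. E (Suc n)"] E by metis
  \<comment> \<open>Otherwise the open set \<open>{}\<close> would contain \<open>L\<close> and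
    hence some \<open>E (Suc n)\<close>.\<close>
  have "L \<noteq> {}"
    using L(2)[of "{}"] E(1) by fastforce
  then obtain x where x: "x \<in> L" by blast
  then have "x \<notin> F n" for n
    using L(1)[of n] E(2)[of n] by blast
  moreover have "x \<in> topspace X"
    using x L(1)[of 0] closure_of_subset_topspace[of X] by blast
  ultimately show False using cover by blast
qed

section \<open>Weston's argument: from nearly open to open\<close>

text \<open>If \<open>p\<close> were outside the closure of \<open>U\<close>, the alternating
  construction would start from \<open>U\<close> and a neighbourhood of \<open>p\<close>. Its limits
  \<open>L\<close> and \<open>M\<close> are disjoint compact sets, so by injectivity their images
  have disjoint neighbourhoods \<open>C\<close> and \<open>D\<close> in \<open>Y\<close>. At a late
  stage \<open>k\<close> the images of \<open>A k\<close> and \<open>B k\<close> fall into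
  \<open>C\<close> and \<open>D\<close>, although the first is dense in an open set containing the
  second.\<close>

lemma nearly_open_image_subset:
  assumes P: "complete_sieve X P" and hY: "Hausdorff_space Y"
    and f: "continuous_map X Y f" and inj: "inj_on f (topspace X)"
    and nearly: "\<And>U. openin X U \<Longrightarrow> f ` U \<subseteq> Y interior_of (Y closure_of (f ` U))"
    and U: "openin X U" and p: "p \<in> topspace X" "f p \<in> Y interior_of (Y closure_of (f ` U))"
  shows "p \<in> X closure_of U"
proof (rule ccontr)
  assume np: "p \<notin> X closure_of U"
  define I where "I = (\<lambda>U. Y interior_of (Y closure_of (f ` U)))"
  have oI: "openin Y (I U)" and Icl: "I U \<subseteq> Y closure_of (f ` U)" for U
    unfolding I_def by (auto simp: interior_of_subset)
  have pre: "openin X {x \<in> D. f x \<in> E}" if "openin X D" "openin Y E" for D E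
    using f that openin_continuous_map_preimage_gen by blast
  \<comment> \<open>\<open>Q\<close> is the invariant of the alternation: the image of
    \<open>V\<close> lies where that of \<open>U\<close> is dense. \<open>R\<close> records one
    round of shrinking.\<close>
  define Q where "Q = (\<lambda>(U, V). openin X U \<and> openin X V \<and> U \<noteq> {} \<and> V \<noteq> {} \<and> f ` V \<subseteq> I U)"
  define R where "R = (\<lambda>n (U, V) (U', V'). U' \<subseteq> U \<and> V' \<subseteq> V \<and> P n U' \<and> P n V')"
  have step: "\<exists>UV'. Q UV' \<and> R n UV UV'" if "Q UV" for UV n
  proof -
    obtain U V where UV: "UV = (U, V)" by (cases UV)
    have Q: "openin X U" "openin X V" "U \<noteq> {}" "V \<noteq> {}" "f ` V \<subseteq> I U"
      using that unfolding UV Q_def by auto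
    obtain v where v: "v \<in> V" using Q by blast
    \<comment> \<open>The point \<open>f v\<close> shows that \<open>I U\<close> meets
      \<open>I V\<close>, so by density some \<open>f u\<close> lies in both. First \<open>U\<close>
      shrinks around \<open>u\<close>; then, since \<open>f u\<close> is in \<open>I U'\<close> and
      in the closure of the image of \<open>V\<close>, a point \<open>w\<close> of \<open>V\<close>
      has \<open>f w\<close> in \<open>I U'\<close>, and \<open>V\<close> shrinks around
      \<open>w\<close>. This restores the invariant.\<close>
    have "f v \<in> I U" "f v \<in> I V"
      using v Q nearly[OF Q(2)] unfolding I_def by auto
    moreover have "openin Y (I U \<inter> I V)" using oI by blast
    moreover have "f v \<in> Y closure_of (f ` U)" using \<open>f v \<in> I U\<close> Icl by blast
    ultimately obtain u where u: "u \<in> U" "f u \<in> I U \<inter> I V"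
      unfolding in_closure_of by blast
    let ?D = "{x \<in> U. f x \<in> I U \<inter> I V}"
    have D: "openin X ?D" "u \<in> ?D"
      using pre[OF Q(1) \<open>openin Y (I U \<inter> I V)\<close>] u by blast+
    obtain U' where U': "openin X U'" "u \<in> U'" "X closure_of U' \<subseteq> ?D" "P n U'" "U' \<subseteq> ?D"
      by (rule complete_sieve_small[OF P D])
    have "f u \<in> I U'"
      using nearly[OF U'(1)] U'(2) unfolding I_def by blast
    moreover have "f u \<in> Y closure_of (f ` V)"
      using u(2) Icl by blast
    ultimately obtain w where w: "w \<in> V" "f w \<in> I U'"
      using oI[of U'] unfolding in_closure_of by blast
    let ?E = "{x \<in> V. f x \<in> I U'}"
    have E: "openin X ?E" "w \<in> ?E"
      using pre[OF Q(2) oI] w by blast+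
    obtain V' where V': "openin X V'" "w \<in> V'" "X closure_of V' \<subseteq> ?E" "P n V'" "V' \<subseteq> ?E"
      by (rule complete_sieve_small[OF P E])
    have "Q (U', V') \<and> R n UV (U', V')"
      using U' V' unfolding Q_def R_def UV by auto
    then show ?thesis by blast
  qed
  \<comment> \<open>The initial \<open>V0\<close> is taken in this neighbourhood of
    \<open>p\<close>: its closure misses that of \<open>U\<close>, which later makes
    \<open>L\<close> and \<open>M\<close> disjoint, and its image lies in
    \<open>I U\<close>.\<close>
  let ?D = "{x \<in> topspace X - X closure_of U. f x \<in> I U}"
  have "openin X ?D" "p \<in> ?D"
    using pre[OF openin_diff[OF openin_topspace closedin_closure_of] oI] p np unfolding I_def by blast+
  then obtain V0 where V0: "openin X V0" "p \<in> V0" "X closure_of V0 \<subseteq> ?D" "P 0 V0" "V0 \<subseteq> ?D"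
    by (rule complete_sieve_small[OF P])
  have "U \<noteq> {}"
    using p(2) by auto
  then have start: "Q (U, V0)"
    using U V0 unfolding Q_def by auto
  obtain S where S: "\<And>n. Q (S n)" "\<And>n. R n (S n) (S (Suc n))" "S 0 = (U, V0)"
  proof -
    have "\<exists>S. \<forall>n. (Q (S n) \<and> (n = 0 \<longrightarrow> S n = (U, V0))) \<and> R n (S n) (S (Suc n))"
      using start step by (intro dependent_nat_choice) auto
    then show thesis using that by blast
  qed
  define A where "A n = fst (S n)" for n
  define B where "B n = snd (S n)" for n
  have A: "openin X (A n)" "A n \<noteq> {}" "A (Suc n) \<subseteq> A n" "P n (A (Suc n))"
   and B: "openin X (B n)" "B n \<noteq> {}" "B (Suc n) \<subseteq> B n" "P n (B (Suc n))"
   and BA: "f ` B n \<subseteq> I (A n)" for n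
    using S(1)[of n] S(2)[of n] unfolding Q_def R_def A_def B_def by (auto split: prod.splits)
  have AB0: "A 0 = U" "B 0 = V0"
    using S(3) by (auto simp: A_def B_def)
  obtain L where L: "compactin X L" "\<And>n. L \<subseteq> X closure_of A (Suc n)"
      "\<And>D. openin X D \<Longrightarrow> L \<subseteq> D \<Longrightarrow> \<exists>n. A (Suc n) \<subseteq> D"
    using complete_sieve_compact[OF P, of "\<lambda>n. A (Suc n)"] A by metis
  obtain M where M: "compactin X M" "\<And>n. M \<subseteq> X closure_of B (Suc n)"
      "\<And>D. openin X D \<Longrightarrow> M \<subseteq> D \<Longrightarrow> \<exists>n. B (Suc n) \<subseteq> D"
    using complete_sieve_compact[OF P, of "\<lambda>n. B (Suc n)"] B by metis
  have "L \<subseteq> X closure_of U" "M \<subseteq> X closure_of V0"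
    using L(2)[of 0] M(2)[of 0] A(3)[of 0] B(3)[of 0] AB0 closure_of_mono by (metis subset_trans)+
  then have "L \<inter> M = {}" "L \<subseteq> topspace X" "M \<subseteq> topspace X"
    using V0(3) closure_of_subset_topspace[of X U] closure_of_subset_topspace[of X V0] by blast+
  then have "disjnt (f ` L) (f ` M)"
    using inj unfolding disjnt_iff inj_on_def by blast
  then obtain C D where CD: "openin Y C" "openin Y D" "f ` L \<subseteq> C" "f ` M \<subseteq> D" "disjnt C D"
    using Hausdorff_space_compact_separation[OF hY image_compactin[OF L(1) f] image_compactin[OF M(1) f]]
    by blast
  have preX: "openin X {x \<in> topspace X. f x \<in> C}" "openin X {x \<in> topspace X. f x \<in> D}"
    using pre CD by auto
  obtain m n where mn: "A (Suc m) \<subseteq> {x \<in> topspace X. f x \<in> C}" "B (Suc n) \<subseteq> {x \<in> topspace X. f x \<in> D}"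
    using L(3)[OF preX(1)] M(3)[OF preX(2)] CD \<open>L \<subseteq> topspace X\<close> \<open>M \<subseteq> topspace X\<close> by blast
  define k where "k = max (Suc m) (Suc n)"
  have "A k \<subseteq> A (Suc m)" "B k \<subseteq> B (Suc n)"
    using decseqD[of A] decseqD[of B] A(3) B(3) unfolding k_def decseq_Suc_iff by auto
  then have fk: "f ` A k \<subseteq> C" "f ` B k \<subseteq> D"
    using mn by auto
  obtain b where b: "b \<in> B k" using B(2) by blast
  then have "f b \<in> Y closure_of (f ` A k)" "f b \<in> D"
    using BA[of k] Icl[of "A k"] fk by auto
  then obtain a where "a \<in> A k" "f a \<in> D"
    using CD(2) unfolding in_closure_of by blast
  then show False
    using fk(1) CD(5) by (auto simp: disjnt_iff)
qed

text \<open>Around a point of \<open>D\<close> take \<open>U\<close> with closure inside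
  \<open>D\<close>. By surjectivity and the preceding lemma, the interior of the closure of the
  image of \<open>U\<close> consists of images of points in the closure of \<open>U\<close>, so it
  is a neighbourhood inside the image of \<open>D\<close>.\<close>

lemma nearly_open_imp_open_map:
  assumes P: "complete_sieve X P" and hY: "Hausdorff_space Y"
    and f: "continuous_map X Y f" and bij: "bij_betw f (topspace X) (topspace Y)"
    and nearly: "\<And>U. openin X U \<Longrightarrow> f ` U \<subseteq> Y interior_of (Y closure_of (f ` U))"
  shows "open_map X Y f"
  unfolding open_map_def
proof (intro allI impI)
  fix D assume D: "openin X D"
  show "openin Y (f ` D)"
  proof (subst openin_subopen, intro ballI)
    fix y assume "y \<in> f ` D"
    then obtain x where x: "x \<in> D" "y = f x" by blast
    obtain U where U: "openin X U" "x \<in> U" "X closure_of U \<subseteq> D"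
      using complete_sieve_small[OF P D x(1)] by metis
    let ?I = "Y interior_of (Y closure_of (f ` U))"
    have "?I \<subseteq> f ` D"
    proof
      fix q assume q: "q \<in> ?I"
      then have "q \<in> topspace Y"
        using interior_of_subset_topspace[of Y] by blast
      then obtain p where p: "p \<in> topspace X" "q = f p"
        using bij unfolding bij_betw_def by blast
      have "p \<in> X closure_of U"
        using nearly_open_image_subset[OF P hY f bij_betw_imp_inj_on[OF bij] nearly U(1) p(1)] q p(2)
        by blast
      then show "q \<in> f ` D" using p U by blast
    qed
    moreover have "y \<in> ?I" using nearly[OF U(1)] U(2) x(2) by blast
    ultimately show "\<exists>T. openin Y T \<and> y \<in> T \<and> T \<subseteq> f ` D"
      by (intro exI[of _ ?I]) simp
  qed
qed

section \<open>Near openness of automorphisms of topological groups\<close>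

context
  fixes G :: "('a, 'b) monoid_scheme" and T :: "'a topology"
  assumes tg: "topological_group G T"
begin

interpretation group G
  using tg unfolding topological_group_def by blast

lemma topspace_carrier: "topspace T = carrier G"
  using tg unfolding topological_group_def by blast

lemma continuous_map_group_mult:
  assumes "continuous_map X T f" "continuous_map X T g"
  shows "continuous_map X T (\<lambda>x. f x \<otimes>\<^bsub>G\<^esub> g x)"
proof -
  have "continuous_map (prod_topology T T) T (\<lambda>(x, y). x \<otimes>\<^bsub>G\<^esub> y)"
    using tg unfolding topological_group_def by blast
  from continuous_map_compose[OF continuous_map_pairedI[OF assms] this]
  show ?thesis by (simp add: o_def)
qed

lemma continuous_map_group_inv:
  assumes "continuous_map X T f"
  shows "continuous_map X T (\<lambda>x. inv\<^bsub>G\<^esub> f x)"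
proof -
  have "continuous_map T T (\<lambda>x. inv\<^bsub>G\<^esub> x)"
    using tg unfolding topological_group_def by blast
  from continuous_map_compose[OF assms this] show ?thesis by (simp add: o_def)
qed

lemma continuous_map_left_translation:
  assumes "a \<in> carrier G"
  shows "continuous_map T T (\<lambda>x. a \<otimes>\<^bsub>G\<^esub> x)"
  using assms by (intro continuous_map_group_mult) (auto simp: topspace_carrier)

text \<open>This is continuity at the pair of identities of the map whose value there is
  \<open>x\<close>. The left quotient of \<open>v\<close> and \<open>u\<close> is what remains when
  a translate of \<open>V\<close> is moved back to \<open>x\<close>.\<close>

lemma neighbourhood_inv_mult_subset:
  assumes U: "openin T U" "x \<in> U"
  obtains V where "openin T V" "\<one>\<^bsub>G\<^esub> \<in> V"
    "\<And>v u. v \<in> V \<Longrightarrow> u \<in> V \<Longrightarrow> x \<otimes>\<^bsub>G\<^esub> (inv\<^bsub>G\<^esub> v \<otimes>\<^bsub>G\<^esub> u) \<in> U"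
proof -
  let ?h = "\<lambda>z. x \<otimes>\<^bsub>G\<^esub> (inv\<^bsub>G\<^esub> (fst z) \<otimes>\<^bsub>G\<^esub> snd z)"
  have x: "x \<in> carrier G"
    using U openin_subset topspace_carrier by blast
  have "continuous_map (prod_topology T T) T ?h"
    using x by (intro continuous_map_group_mult continuous_map_group_inv continuous_map_fst
        continuous_map_snd) (auto simp: topspace_carrier)
  then have op: "openin (prod_topology T T) {z \<in> topspace (prod_topology T T). ?h z \<in> U}"
    using U(1) openin_continuous_map_preimage by blast
  have "(\<one>\<^bsub>G\<^esub>, \<one>\<^bsub>G\<^esub>) \<in> {z \<in> topspace (prod_topology T T). ?h z \<in> U}"
    using U x by (simp add: topspace_carrier)
  then obtain A B where AB: "openin T A" "openin T B" "\<one>\<^bsub>G\<^esub> \<in> A" "\<one>\<^bsub>G\<^esub> \<in> B"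
    "A \<times> B \<subseteq> {z \<in> topspace (prod_topology T T). ?h z \<in> U}"
    by (elim op[unfolded openin_prod_topology_alt, rule_format, elim_format] exE conjE)
  show thesis
  proof (rule that[of "A \<inter> B"])
    fix v u assume "v \<in> A \<inter> B" "u \<in> A \<inter> B"
    then have "(v, u) \<in> A \<times> B" by blast
    then show "x \<otimes>\<^bsub>G\<^esub> (inv\<^bsub>G\<^esub> v \<otimes>\<^bsub>G\<^esub> u) \<in> U" using AB(5) by auto
  qed (use AB in auto)
qed

text \<open>The group is covered by the images under \<open>f\<close> of countably many translates
  of \<open>V\<close>, so by Baire category the closure of one of these images has nonempty interior
  \<open>W\<close>. A left translation by some \<open>f c\<close> carries that image into the image
  of \<open>U\<close> and a point of \<open>W\<close> to \<open>f x\<close>.\<close>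

lemma nearly_open_automorphism:
  assumes narrow: "omega_narrow G T" and P: "complete_sieve T P"
    and iso: "f \<in> iso G G" and U: "openin T U"
  shows "f ` U \<subseteq> T interior_of (T closure_of (f ` U))"
proof
  fix y assume "y \<in> f ` U"
  then obtain x where x: "x \<in> U" "y = f x" by blast
  obtain V where V: "openin T V" "\<one>\<^bsub>G\<^esub> \<in> V"
    "\<And>v u. v \<in> V \<Longrightarrow> u \<in> V \<Longrightarrow> x \<otimes>\<^bsub>G\<^esub> (inv\<^bsub>G\<^esub> v \<otimes>\<^bsub>G\<^esub> u) \<in> U"
    using neighbourhood_inv_mult_subset[OF U x(1)] by metis
  have VG: "V \<subseteq> carrier G" and xG: "x \<in> carrier G"
    using V(1) U x(1) openin_subset topspace_carrier by blast+
  obtain S where S: "S \<subseteq> carrier G" "countable S"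
    "carrier G = {s \<otimes>\<^bsub>G\<^esub> u | s u. s \<in> S \<and> u \<in> V}"
    using narrow V unfolding omega_narrow_def by meson
  have "S \<noteq> {}"
    using S(3) one_closed by blast
  have r: "range (from_nat_into S) = S"
    using range_from_nat_into[OF \<open>S \<noteq> {}\<close> S(2)] .
  have hom: "f \<in> hom G G" and bij: "bij_betw f (carrier G) (carrier G)"
    using iso unfolding iso_def by auto
  then have fG: "f a \<in> carrier G" if "a \<in> carrier G" for a
    using that by (auto simp: hom_def)
  have fm: "f (a \<otimes>\<^bsub>G\<^esub> b) = f a \<otimes>\<^bsub>G\<^esub> f b" if "a \<in> carrier G" "b \<in> carrier G" for a b
    using hom that by (auto simp: hom_def)
  let ?E = "\<lambda>s. (\<lambda>u. f (s \<otimes>\<^bsub>G\<^esub> u)) ` V"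
  have "topspace T \<subseteq> (\<Union>n. T closure_of ?E (from_nat_into S n))"
  proof
    fix z assume "z \<in> topspace T"
    then obtain a where a: "a \<in> carrier G" "z = f a"
      using bij topspace_carrier unfolding bij_betw_def by blast
    then obtain s u where su: "s \<in> S" "u \<in> V" "a = s \<otimes>\<^bsub>G\<^esub> u"
      using S(3) by blast
    obtain n where n: "s = from_nat_into S n"
      using r su(1) by (metis imageE)
    have "?E s \<subseteq> topspace T"
      using VG S(1) su(1) by (auto simp: topspace_carrier intro!: fG m_closed)
    from closure_of_subset[OF this] have "z \<in> T closure_of ?E s"
      using su a by blast
    then show "z \<in> (\<Union>n. T closure_of ?E (from_nat_into S n))"
      using n by blast
  qed
  moreover have "topspace T \<noteq> {}"
    using one_closed topspace_carrier by blast
  ultimately obtain n where n: "T interior_of (T closure_of ?E (from_nat_into S n)) \<noteq> {}"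
    using complete_sieve_Baire[OF P, of "\<lambda>n. T closure_of ?E (from_nat_into S n)"]
    by (metis closedin_closure_of)
  define s where "s = from_nat_into S n"
  have sG: "s \<in> carrier G"
    using r S(1) unfolding s_def by blast
  define W where "W = T interior_of (T closure_of ?E s)"
  have W: "openin T W" "W \<subseteq> T closure_of ?E s" "W \<noteq> {}"
    using n unfolding W_def s_def by (auto simp: interior_of_subset)
  \<comment> \<open>An open set meeting a closure meets the set itself, so \<open>W\<close> contains
    a point of the image itself.\<close>
  then obtain v where v: "v \<in> V" "f (s \<otimes>\<^bsub>G\<^esub> v) \<in> W"
    unfolding in_closure_of subset_iff by blast
  have vG: "v \<in> carrier G" using v VG by blast
  \<comment> \<open>Chosen so that left translation by \<open>c\<close> takes the product of
    \<open>s\<close> and \<open>v\<close> to \<open>x\<close>; the factor \<open>s\<close> then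
    cancels in \<open>csv\<close>.\<close>
  define c where "c = x \<otimes>\<^bsub>G\<^esub> inv\<^bsub>G\<^esub> (s \<otimes>\<^bsub>G\<^esub> v)"
  have cG: "c \<in> carrier G" unfolding c_def using xG sG vG by simp
  have csv: "c \<otimes>\<^bsub>G\<^esub> (s \<otimes>\<^bsub>G\<^esub> u) = x \<otimes>\<^bsub>G\<^esub> (inv\<^bsub>G\<^esub> v \<otimes>\<^bsub>G\<^esub> u)" if "u \<in> carrier G" for u
  proof -
    have "inv\<^bsub>G\<^esub> s \<otimes>\<^bsub>G\<^esub> (s \<otimes>\<^bsub>G\<^esub> u) = u"
      using that sG by (simp add: m_assoc[symmetric])
    then show ?thesis
      unfolding c_def using that xG sG vG by (simp add: inv_mult_group m_assoc)
  qed
  let ?g = "\<lambda>z. inv\<^bsub>G\<^esub> f c \<otimes>\<^bsub>G\<^esub> z"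
  have inv_c: "?g (f c \<otimes>\<^bsub>G\<^esub> z) = z" "f c \<otimes>\<^bsub>G\<^esub> ?g z = z" if "z \<in> carrier G" for z
    using that cG fG by (simp_all add: m_assoc[symmetric])
  \<comment> \<open>This is the translate of \<open>W\<close> by \<open>f c\<close>, written as a
    preimage under the inverse translation so that continuity gives openness.\<close>
  define W' where "W' = {z \<in> topspace T. ?g z \<in> W}"
  have oW': "openin T W'"
    unfolding W'_def using W(1) cG fG
    by (intro openin_continuous_map_preimage[OF continuous_map_left_translation]) auto
  have "f c \<otimes>\<^bsub>G\<^esub> f (s \<otimes>\<^bsub>G\<^esub> v) = f (c \<otimes>\<^bsub>G\<^esub> (s \<otimes>\<^bsub>G\<^esub> v))"
    using fm cG sG vG by simp
  also have "\<dots> = f x"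
    using csv[OF vG] vG xG by simp
  finally have "?g (f x) = f (s \<otimes>\<^bsub>G\<^esub> v)"
    using inv_c(1) fG sG vG by (metis m_closed)
  then have "y \<in> W'"
    using v(2) x(2) xG fG unfolding W'_def topspace_carrier by simp
  moreover have "W' \<subseteq> T closure_of (f ` U)"
  proof
    fix z assume z: "z \<in> W'"
    then have zG: "z \<in> carrier G" and gz: "?g z \<in> T closure_of ?E s"
      using W(2) unfolding W'_def topspace_carrier by auto
    have "f c \<otimes>\<^bsub>G\<^esub> ?g z \<in> T closure_of ((\<lambda>z. f c \<otimes>\<^bsub>G\<^esub> z) ` ?E s)"
      using continuous_map_image_closure_subset[OF continuous_map_left_translation[OF fG[OF cG]]] gz
      by blast
    moreover have "(\<lambda>z. f c \<otimes>\<^bsub>G\<^esub> z) ` ?E s \<subseteq> f ` U"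
    proof clarify
      fix u assume u: "u \<in> V"
      have "f c \<otimes>\<^bsub>G\<^esub> f (s \<otimes>\<^bsub>G\<^esub> u) = f (x \<otimes>\<^bsub>G\<^esub> (inv\<^bsub>G\<^esub> v \<otimes>\<^bsub>G\<^esub> u))"
        using csv fm cG sG u VG by (metis m_closed subsetD)
      then show "f c \<otimes>\<^bsub>G\<^esub> f (s \<otimes>\<^bsub>G\<^esub> u) \<in> f ` U"
        using V(3)[OF v(1) u] by blast
    qed
    ultimately show "z \<in> T closure_of (f ` U)"
      using inv_c(2)[OF zG] closure_of_mono by (metis subsetD)
  qed
  ultimately show "y \<in> T interior_of (T closure_of (f ` U))"
    using oW' unfolding interior_of_def by blast
qed

end

theorem theorem3p1:
  fixes G :: "('a, 'b) monoid_scheme" and T :: "'a topology"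
  assumes "topological_group G T"
    and "omega_narrow G T"
    and "cech_complete T"
  shows "g_reversible G T"
  unfolding g_reversible_def
proof (intro allI impI; elim conjE)
  fix f assume f: "f \<in> iso G G" "continuous_map T T f"
  obtain P where P: "complete_sieve T P"
    using cech_complete_imp_complete_sieve[OF assms(3)] .
  have T: "Hausdorff_space T" "topspace T = carrier G"
    using assms(1) unfolding topological_group_def by auto
  have "bij_betw f (topspace T) (topspace T)"
    using f(1) T(2) unfolding iso_def by simp
  then show "open_map T T f"
    using nearly_open_imp_open_map[OF P T(1) f(2)] nearly_open_automorphism[OF assms(1,2) P f(1)]
    by blast
qed

end
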